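(* Let $0<\theta<1$ and let $\phi$ be a finite Blaschke product with $\phi(0)=0$ whose local degree at the origin is $p\ge2$. Then there exist nonzero $f,g\in\mathcal{H}_\theta$ and constants $C'>0$, $\beta'>0$ such that $$\mathcal{C}_{f,g}(n)\ \ge\ C'e^{-\beta' e^{\gamma n}}\|f\|_\theta\|g\|_\theta,\qquad \gamma=\log p,$$ for infinitely many $n\in\mathbb{N}$.
   Context: $\mathbb{S}^1=\{|z|=1\}$, $d\mu(z)=\frac{1}{2\pi i}\frac{dz}{z}$ is normalized Lebesgue measure on $\mathbb{S}^1$. A finite Blaschke product is a map $\phi(z)=e^{i\psi}\prod_{i=1}^q\frac{z-\lambda_i}{1-\overline{\lambda_i}z}$ with $\psi\in[0,2\pi)$, $|\lambda_i|<1$, $q\ge1$. The local degree of $\phi$ at the origin (where $\phi(0)=0$) is the order of vanishing of $\phi$ at $0$. For $0<\theta<1$, $\mathcal{H}_\theta$ is the closure of the linear combinations of $z^k$, $k\in\mathbb{Z}$, with respect to $\|f\|_\theta=\sqrt{\sum_{k\in\mathbb{Z}}|f_k|^2\theta^{-2|k|}}$, where $f_k$ are the Fourier coefficients of $f$. With $\phi^n$ the $n$-fold iterate of $\phi$, $\mathcal{C}_{f,g}(n)=\left|\int_{\mathbb{S}^1}(f\circ\phi^n)\,\overline{g}\,d\mu-\int_{\mathbb{S}^1}f\,d\mu\int_{\mathbb{S}^1}\overline{g}\,d\mu\right|$. *)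

theory Defs
  imports "HOL-Complex_Analysis.Complex_Analysis"
begin

text \<open>
  Functions on the unit circle are represented by functions on \<open>complex\<close>, of which only the
  values on \<open>sphere 0 1\<close> matter.  The integral is taken with respect to
  \<open>d\<mu>(z) = dz / (2 \<pi> i z)\<close>.
\<close>

definition circle_integral :: "(complex \<Rightarrow> complex) \<Rightarrow> complex" where
  "circle_integral f =
     1 / (2 * of_real pi * \<i>) * contour_integral (circlepath 0 1) (\<lambda>z. f z / z)"

definition fourier_coeff :: "(complex \<Rightarrow> complex) \<Rightarrow> int \<Rightarrow> complex" where
  "fourier_coeff f k = circle_integral (\<lambda>z. f z * z powi (- k))"

definition finite_blaschke_product :: "(complex \<Rightarrow> complex) \<Rightarrow> bool" where
  "finite_blaschke_product \<phi> \<longleftrightarrow>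
     (\<exists>\<psi> q a. 0 \<le> \<psi> \<and> \<psi> < 2 * pi \<and> (1::nat) \<le> q \<and> (\<forall>i\<in>{1..q}. norm (a i) < 1) \<and>
        \<phi> = (\<lambda>z. exp (\<i> * of_real \<psi>) * (\<Prod>i=1..q. (z - a i) / (1 - cnj (a i) * z))))"

definition theta_term :: "real \<Rightarrow> (complex \<Rightarrow> complex) \<Rightarrow> int \<Rightarrow> real" where
  "theta_term \<theta> f k = (norm (fourier_coeff f k))\<^sup>2 * \<theta> powi (- 2 * \<bar>k\<bar>)"

text \<open>
  The norm is only meaningful if \<^term>\<open>theta_term \<theta> f\<close> is summable; otherwise
  \<^const>\<open>infsum\<close> is zero.
\<close>

definition theta_norm :: "real \<Rightarrow> (complex \<Rightarrow> complex) \<Rightarrow> real" where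
  "theta_norm \<theta> f = sqrt (\<Sum>\<^sub>\<infinity>k. theta_term \<theta> f k)"

definition laurent_polynomial :: "(complex \<Rightarrow> complex) \<Rightarrow> bool" where
  "laurent_polynomial P \<longleftrightarrow>
     (\<exists>(K::int set) c. finite K \<and> P = (\<lambda>z. \<Sum>k\<in>K. c k * z powi k))"

text \<open>
  The closure is taken among the continuous functions on the circle.  For \<open>0 < \<theta> < 1\<close> the
  norm dominates the supremum norm up to a constant on Laurent polynomials (Cauchy-Schwarz),
  so their abstract completion is a space of continuous functions and this is no restriction.
\<close>

definition H_theta :: "real \<Rightarrow> (complex \<Rightarrow> complex) set" where
  "H_theta \<theta> =
     {f. continuous_on (sphere 0 1) f \<and>
         (\<forall>\<epsilon>>0. \<exists>P. laurent_polynomial P \<and>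
            theta_term \<theta> (\<lambda>z. f z - P z) summable_on UNIV \<and>
            theta_norm \<theta> (\<lambda>z. f z - P z) < \<epsilon>)}"

definition correlation ::
    "(complex \<Rightarrow> complex) \<Rightarrow> (complex \<Rightarrow> complex) \<Rightarrow> (complex \<Rightarrow> complex) \<Rightarrow> nat \<Rightarrow> real" where
  "correlation \<phi> f g n =
     norm (circle_integral (\<lambda>z. f ((\<phi> ^^ n) z) * cnj (g z))
           - circle_integral f * circle_integral (\<lambda>z. cnj (g z)))"

end

theory Submission
  imports Defs
begin

text \<open>
  Pairing with the Szego kernel \<open>K\<^sub>w(z) = 1 / (1 - cnj w * z)\<close> evaluates a function in the
  disc algebra at the point \<open>w\<close> of the disc.  For \<open>f(z) = z\<close> and \<open>g = K\<^sub>w\<close> the product of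
  the two means vanishes, and the correlation is exactly \<open>\<bar>\<phi>\<^sup>n(w)\<bar>\<close>
  (\<open>correlation_identity_szego\<close>).  So the decay of correlations is the rate at which a single
  orbit falls into the superattracting fixed point \<open>0\<close>, and it remains to show that
  this orbit cannot fall faster than doubly exponentially, with base \<open>p\<close>.

  Near \<open>0\<close> the map satisfies \<open>\<bar>\<phi>(z)\<bar> \<ge> c \<bar>z\<bar>\<^sup>p\<close> (\<open>zorder_norm_lower_bound\<close>), and by the
  Schwarz lemma an orbit that starts near \<open>0\<close> stays there.  Iterating the estimate gives
  \<open>\<bar>\<phi>\<^sup>n(w)\<bar> \<ge> (c \<bar>w\<bar>)^(p^n)\<close> (\<open>funpow_norm_lower_bound\<close>), which is
  \<open>exp (- \<beta>' exp (\<gamma> n))\<close> with \<open>\<beta>' = - ln (c \<bar>w\<bar>)\<close>.  The bound holds for every \<open>n\<close>.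

  The Fourier coefficients of \<open>K\<^sub>w\<close> are the powers of \<open>cnj w\<close>, so \<open>K\<^sub>w\<close> lies in the weighted
  space as soon as \<open>\<bar>w\<bar> < \<theta>\<close> (\<open>szego_kernel_in_H_theta\<close>); such a \<open>w\<close> can be taken nonzero and
  arbitrarily close to \<open>0\<close>.
\<close>

section \<open>The circle integral\<close>

text \<open>
  As the mean of \<open>f\<close> over the circle, the integral visibly depends on the boundary values alone
  and commutes with conjugation.
\<close>

lemma circle_integral_eq_integral:
  "circle_integral f = integral {0..1} (\<lambda>t. f (circlepath 0 1 t))"
proof -
  have [simp]: "circlepath 0 1 t \<noteq> 0" for t
    by (simp add: circlepath)
  have "contour_integral (circlepath 0 1) (\<lambda>z. f z / z) =
        integral {0..1} (\<lambda>t. 2 * of_real pi * \<i> * f (circlepath 0 1 t))"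
    unfolding contour_integral_integral
    by (intro integral_cong, unfold vector_derivative_circlepath) (simp add: circlepath)
  then show ?thesis
    by (simp add: circle_integral_def)
qed

lemma circle_integral_cong:
  assumes "\<And>z. norm z = 1 \<Longrightarrow> f z = g z"
  shows "circle_integral f = circle_integral g"
  unfolding circle_integral_eq_integral
  by (intro integral_cong assms) (simp add: circlepath)

lemma circle_integral_cnj: "circle_integral (\<lambda>z. cnj (f z)) = cnj (circle_integral f)"
  by (simp add: circle_integral_eq_integral Henstock_Kurzweil_Integration.integral_cnj)

lemma circle_integral_cmult: "circle_integral (\<lambda>z. c * f z) = c * circle_integral f"
  by (simp add: circle_integral_eq_integral)

section \<open>The Szego kernel\<close>

definition szego_kernel :: "complex \<Rightarrow> complex \<Rightarrow> complex" where
  "szego_kernel w z = 1 / (1 - cnj w * z)"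

lemma szego_denominator_nonzero:
  assumes "norm w < 1" and "norm z \<le> 1"
  shows "1 - cnj w * z \<noteq> 0"
proof
  assume "1 - cnj w * z = 0"
  then have "norm w * norm z = 1"
    by (metis complex_mod_cnj eq_iff_diff_eq_0 norm_mult norm_one)
  moreover have "norm w * norm z \<le> norm w * 1"
    using assms by (intro mult_left_mono) auto
  ultimately show False
    using assms by linarith
qed

text \<open>
  The reproducing property.  On the unit circle \<open>cnj z = 1 / z\<close>, so the conjugate of the kernel
  is \<open>z / (z - w)\<close>, which turns the integral into Cauchy's formula for \<open>F w\<close>.
\<close>

lemma circle_integral_szego:
  assumes "continuous_on (cball 0 1) F" and "F holomorphic_on ball 0 1" and "norm w < 1"
  shows "circle_integral (\<lambda>z. F z * cnj (szego_kernel w z)) = F w"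
proof -
  have "circle_integral (\<lambda>z. F z * cnj (szego_kernel w z)) = circle_integral (\<lambda>z. z * (F z / (z - w)))"
  proof (rule circle_integral_cong)
    fix z :: complex assume z: "norm z = 1"
    then have "z * cnj z = 1"
      by (simp add: complex_norm_square [symmetric])
    moreover from this have "z \<noteq> 0" by auto
    moreover have "1 - w * cnj z \<noteq> 0"
      using szego_denominator_nonzero[of "cnj w" "cnj z"] assms z by simp
    moreover have "z - w \<noteq> 0" using assms z by auto
    moreover have "z * (1 - w * cnj z) = z - w"
      using \<open>z * cnj z = 1\<close> by (simp add: algebra_simps)
    ultimately show "F z * cnj (szego_kernel w z) = z * (F z / (z - w))"
      by (simp add: szego_kernel_def field_simps)
  qed
  also have "\<dots> = 1 / (2 * of_real pi * \<i>) * contour_integral (circlepath 0 1) (\<lambda>z. F z / (z - w))"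
    unfolding circle_integral_def
    by (intro arg_cong2[where f = "(*)"] refl contour_integral_cong) auto
  also have "contour_integral (circlepath 0 1) (\<lambda>z. F z / (z - w)) = 2 * of_real pi * \<i> * F w"
    using assms by (intro contour_integral_unique Cauchy_integral_circlepath) auto
  finally show ?thesis by simp
qed

lemma circle_integral_mean_value:
  assumes "continuous_on (cball 0 1) F" and "F holomorphic_on ball 0 1"
  shows "circle_integral F = F 0"
  using circle_integral_szego[OF assms, of 0] by (simp add: szego_kernel_def)

lemma szego_kernel_continuous_on: "norm w < 1 \<Longrightarrow> continuous_on (cball 0 1) (szego_kernel w)"
  unfolding szego_kernel_def[abs_def]
  by (intro continuous_intros) (use szego_denominator_nonzero[of w] in auto)

lemma szego_kernel_holomorphic_on: "norm w < 1 \<Longrightarrow> szego_kernel w holomorphic_on ball 0 1"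
  unfolding szego_kernel_def[abs_def]
  by (intro holomorphic_intros) (use szego_denominator_nonzero[of w] in auto)

text \<open>
  Removing the first \<open>N\<close> terms of the geometric series of the kernel leaves
  \<open>(cnj w * z) ^ N * szego_kernel w z\<close>.  Its coefficients need no expansion: for \<open>k \<ge> N\<close> the
  conjugate of the integral pairs \<open>z ^ (k - N)\<close> with the kernel, and for \<open>k < N\<close> the integrand
  is holomorphic in the disc and vanishes at the centre.
\<close>

lemma fourier_coeff_szego_tail:
  assumes w: "norm w < 1"
  shows "fourier_coeff (\<lambda>z. (cnj w * z) ^ N * szego_kernel w z) k =
         (if int N \<le> k then cnj w ^ nat k else 0)"
proof (cases "int N \<le> k")
  case True
  define m where "m = nat k - N"
  have k: "k = int (N + m)" using True by (simp add: m_def)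
  have "fourier_coeff (\<lambda>z. (cnj w * z) ^ N * szego_kernel w z) k =
        circle_integral (\<lambda>z. cnj w ^ N * cnj (z ^ m * cnj (szego_kernel w z)))"
    unfolding fourier_coeff_def
  proof (rule circle_integral_cong)
    fix z :: complex assume z: "norm z = 1"
    then have "z * cnj z = 1"
      by (simp add: complex_norm_square [symmetric])
    then have nz: "z \<noteq> 0" and inv: "inverse z = cnj z"
      by (auto simp: inverse_unique)
    have "z powi - k = inverse (z ^ (N + m))"
      unfolding k power_int_minus power_int_of_nat ..
    then have "z ^ N * z powi - k = inverse z ^ m"
      using nz by (simp add: power_add power_inverse field_simps)
    then show "(cnj w * z) ^ N * szego_kernel w z * z powi - k =
        cnj w ^ N * cnj (z ^ m * cnj (szego_kernel w z))"
      using inv by (simp add: power_mult_distrib)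
  qed
  also have "\<dots> = cnj w ^ N * cnj (w ^ m)"
    unfolding circle_integral_cmult circle_integral_cnj
    using circle_integral_szego[of "\<lambda>z. z ^ m" w] w
    by (simp add: continuous_intros holomorphic_intros)
  finally show ?thesis
    using True k by (simp add: power_add nat_add_distrib)
next
  case False
  define m where "m = nat (int N - k)"
  have m: "m > 0" and k: "int m = int N - k" using False by (auto simp: m_def)
  have "fourier_coeff (\<lambda>z. (cnj w * z) ^ N * szego_kernel w z) k =
        circle_integral (\<lambda>z. cnj w ^ N * (z ^ m * szego_kernel w z))"
    unfolding fourier_coeff_def
  proof (rule circle_integral_cong)
    fix z :: complex assume "norm z = 1"
    then have "z \<noteq> 0" by auto
    then have "z ^ N * z powi - k = z powi (int N - k)"
      by (simp add: power_int_diff power_int_minus field_simps)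
    also have "\<dots> = z ^ m"
      by (simp flip: k)
    finally show "(cnj w * z) ^ N * szego_kernel w z * z powi - k =
        cnj w ^ N * (z ^ m * szego_kernel w z)"
      by (simp add: power_mult_distrib)
  qed
  also have "\<dots> = 0"
    unfolding circle_integral_cmult
    using circle_integral_mean_value[of "\<lambda>z. z ^ m * szego_kernel w z"] m
      szego_kernel_continuous_on[OF w] szego_kernel_holomorphic_on[OF w]
    by (simp add: continuous_intros holomorphic_intros)
  finally show ?thesis using False by simp
qed

text \<open>
  The weighted squared coefficients form a geometric series with ratio \<open>(norm w / \<theta>)\<^sup>2\<close>; this
  is where \<open>norm w < \<theta>\<close> enters.
\<close>

lemma theta_term_szego_tail_has_sum:
  fixes w :: complex
  assumes \<theta>: "0 < \<theta>" "\<theta> < 1" and w: "norm w < \<theta>"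
  defines "x \<equiv> (norm w / \<theta>)\<^sup>2"
  shows "(theta_term \<theta> (\<lambda>z. (cnj w * z) ^ N * szego_kernel w z) has_sum (x ^ N / (1 - x))) UNIV"
proof -
  have w1: "norm w < 1" using assms by linarith
  have x: "0 \<le> x" "x < 1"
    using assms by (auto simp: x_def power_less_one_iff abs_square_less_1)
  let ?t = "theta_term \<theta> (\<lambda>z. (cnj w * z) ^ N * szego_kernel w z)"
  have t: "?t (int (N + m)) = x ^ N * x ^ m" for m
  proof -
    have "\<theta> powi (- 2 * \<bar>int (N + m)\<bar>) = inverse ((\<theta>\<^sup>2) ^ (N + m))"
    proof -
      have "- 2 * \<bar>int (N + m)\<bar> = - int (2 * (N + m))" by simp
      then show ?thesis
        by (simp only: power_int_minus power_int_of_nat power_mult)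
    qed
    then show ?thesis
      unfolding theta_term_def fourier_coeff_szego_tail[OF w1]
      by (simp add: x_def nat_add_distrib norm_power norm_mult power_add power_divide
            power_mult_distrib field_simps flip: power_mult)
  qed
  have "((\<lambda>m. x ^ N * x ^ m) sums (x ^ N * (1 / (1 - x))))"
    using x by (intro sums_mult geometric_sums) auto
  then have "((\<lambda>m. x ^ N * x ^ m) has_sum (x ^ N / (1 - x))) UNIV"
    using x by (intro sums_nonneg_imp_has_sum) auto
  then have "(?t has_sum (x ^ N / (1 - x))) (range (\<lambda>m. int (N + m)))"
    by (subst has_sum_reindex) (auto simp: inj_on_def o_def t simp del: of_nat_add)
  then show ?thesis
  proof (rule has_sum_cong_neutral[THEN iffD1, rotated -1])
    fix k assume k: "k \<in> UNIV - range (\<lambda>m. int (N + m))"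
    have "k < int N"
    proof (rule ccontr)
      assume "\<not> k < int N"
      then have "k = int (N + nat (k - int N))" by simp
      with k show False by blast
    qed
    then show "?t k = 0"
      by (simp add: theta_term_def fourier_coeff_szego_tail[OF w1])
  qed auto
qed

lemma theta_term_cong:
  assumes "\<And>z. norm z = 1 \<Longrightarrow> f z = g z"
  shows "theta_term \<theta> f = theta_term \<theta> g"
  unfolding theta_term_def fourier_coeff_def
  using circle_integral_cong[of "\<lambda>z. f z * z powi - k" "\<lambda>z. g z * z powi - k" for k] assms
  by (intro ext) simp

text \<open>
  The partial sums of the geometric series approximate the kernel: on the circle the errors are
  the tails above, whose squared norms \<open>x ^ N / (1 - x)\<close> tend to zero.
\<close>

lemma szego_kernel_in_H_theta:
  assumes \<theta>: "0 < \<theta>" "\<theta> < 1" and w: "norm w < \<theta>"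
  shows "szego_kernel w \<in> H_theta \<theta>"
proof -
  define x where "x = (norm w / \<theta>)\<^sup>2"
  define P where "P N z = (\<Sum>k\<in>int ` {..<N}. cnj w powi k * z powi k)" for N :: nat and z
  have w1: "norm w < 1" using assms by linarith
  have x: "0 \<le> x" "x < 1"
    using assms by (auto simp: x_def power_less_one_iff abs_square_less_1)
  have tail: "theta_term \<theta> (\<lambda>z. szego_kernel w z - P N z) =
              theta_term \<theta> (\<lambda>z. (cnj w * z) ^ N * szego_kernel w z)" for N
  proof (rule theta_term_cong)
    fix z :: complex assume z: "norm z = 1"
    have nz: "1 - cnj w * z \<noteq> 0"
      using szego_denominator_nonzero[OF w1] z by simp
    have "P N z = (\<Sum>k<N. (cnj w * z) ^ k)"
      by (simp add: P_def sum.reindex power_mult_distrib)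
    also have "\<dots> = (1 - (cnj w * z) ^ N) / (1 - cnj w * z)"
      using nz by (subst sum_gp_strict) auto
    finally show "szego_kernel w z - P N z = (cnj w * z) ^ N * szego_kernel w z"
      using nz by (simp add: szego_kernel_def diff_divide_distrib)
  qed
  note sums = theta_term_szego_tail_has_sum[OF assms, folded x_def tail]
  have "\<exists>Q. laurent_polynomial Q \<and> theta_term \<theta> (\<lambda>z. szego_kernel w z - Q z) summable_on UNIV \<and>
          theta_norm \<theta> (\<lambda>z. szego_kernel w z - Q z) < \<epsilon>" if "\<epsilon> > 0" for \<epsilon>
  proof -
    have "(\<lambda>N. sqrt (x ^ N / (1 - x))) \<longlonglongrightarrow> sqrt (0 / (1 - x))"
      using x by (intro tendsto_intros LIMSEQ_power_zero) auto
    then have "\<forall>\<^sub>F N in sequentially. sqrt (x ^ N / (1 - x)) < \<epsilon>"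
      using that by (intro order_tendstoD(2)) auto
    then obtain N where N: "sqrt (x ^ N / (1 - x)) < \<epsilon>"
      by (auto simp: eventually_sequentially)
    have "laurent_polynomial (P N)"
      unfolding laurent_polynomial_def P_def
      by (intro exI[of _ "int ` {..<N}"] exI[of _ "\<lambda>k. cnj w powi k"]) auto
    with sums[of N] N show ?thesis
      by (intro exI[of _ "P N"]) (auto simp: theta_norm_def infsumI has_sum_imp_summable)
  qed
  moreover have "continuous_on (sphere 0 1) (szego_kernel w)"
    using szego_kernel_continuous_on[OF w1] by (rule continuous_on_subset) auto
  ultimately show ?thesis
    by (auto simp: H_theta_def)
qed

lemma laurent_polynomial_in_H_theta:
  assumes "laurent_polynomial P" and "continuous_on (sphere 0 1) P"
  shows "P \<in> H_theta \<theta>"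
proof -
  have "theta_term \<theta> (\<lambda>z. 0) = (\<lambda>_. 0)"
    by (simp add: theta_term_def fourier_coeff_def circle_integral_def fun_eq_iff)
  then show ?thesis
    using assms by (auto simp: H_theta_def theta_norm_def intro!: exI[of _ P])
qed

section \<open>Orbits near a superattracting fixed point\<close>

lemma Schwarz_funpow:
  fixes \<phi> :: "'a::real_normed_vector \<Rightarrow> 'a"
  assumes "\<And>z. norm z < 1 \<Longrightarrow> norm (\<phi> z) \<le> norm z" and "norm z < 1"
  shows "norm ((\<phi> ^^ n) z) \<le> norm z"
proof (induction n)
  case (Suc n)
  then show ?case using assms(1)[of "(\<phi> ^^ n) z"] assms(2) by simp
qed auto

text \<open>
  Each step raises the lower bound to the power \<open>p\<close> and costs one factor \<open>c\<close>, so \<open>n\<close> steps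
  cost \<open>c ^ (1 + p + \<dots> + p ^ (n - 1))\<close>.  Since \<open>p \<ge> 2\<close>, that exponent is less than \<open>p ^ n\<close>.
\<close>

lemma funpow_norm_lower_bound:
  fixes \<phi> :: "'a::real_normed_vector \<Rightarrow> 'a"
  assumes lower: "\<And>z. norm z \<le> \<delta> \<Longrightarrow> c * norm z ^ p \<le> norm (\<phi> z)"
    and orbit: "\<And>n. norm ((\<phi> ^^ n) z) \<le> \<delta>"
    and c: "0 < c" "c \<le> 1" and p: "2 \<le> p"
  shows "(c * norm z) ^ (p ^ n) \<le> norm ((\<phi> ^^ n) z)"
proof -
  \<comment> \<open>The extra factor \<open>c\<close> makes the induction close: raised to the power \<open>p \<ge> 2\<close> it supplies
    both the \<open>c\<close> consumed by the next step and the \<open>c\<close> to be carried along.\<close>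
  have "(c * norm z) ^ (p ^ n) \<le> c * norm ((\<phi> ^^ n) z)"
  proof (induction n)
    case (Suc n)
    have "(c * norm z) ^ (p ^ Suc n) = ((c * norm z) ^ (p ^ n)) ^ p"
      by (simp add: mult.commute flip: power_mult)
    also have "\<dots> \<le> (c * norm ((\<phi> ^^ n) z)) ^ p"
      using Suc c by (intro power_mono) auto
    also have "\<dots> = c ^ p * norm ((\<phi> ^^ n) z) ^ p"
      by (simp add: power_mult_distrib)
    also have "\<dots> \<le> c ^ 2 * norm ((\<phi> ^^ n) z) ^ p"
      using c p by (intro mult_right_mono power_decreasing) auto
    also have "\<dots> = c * (c * norm ((\<phi> ^^ n) z) ^ p)"
      by (simp add: power2_eq_square)
    also have "\<dots> \<le> c * norm ((\<phi> ^^ Suc n) z)"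
      using lower[OF orbit[of n]] c by (intro mult_left_mono) auto
    finally show ?case .
  qed auto
  also have "\<dots> \<le> 1 * norm ((\<phi> ^^ n) z)"
    using c by (intro mult_right_mono) auto
  finally show ?thesis by simp
qed

text \<open>
  Locally \<open>\<phi> z = h z * z ^ p\<close> with \<open>h\<close> continuous and without zeros on a closed disc, hence bounded
  away from zero there by compactness.
\<close>

lemma zorder_norm_lower_bound:
  assumes hol: "\<phi> holomorphic_on ball 0 1" and z0: "\<phi> 0 = 0"
    and nonzero: "\<exists>w\<in>ball 0 1. \<phi> w \<noteq> 0" and p: "zorder \<phi> 0 = int p"
  obtains \<delta> c where "0 < \<delta>" "\<delta> < 1" "0 < c" "c \<le> 1"
    "\<And>z. norm z \<le> \<delta> \<Longrightarrow> c * norm z ^ p \<le> norm (\<phi> z)"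
proof -
  define h where "h = zor_poly \<phi> 0"
  obtain r where r: "0 < r" "cball 0 r \<subseteq> ball (0::complex) 1" and h: "h holomorphic_on cball 0 r"
    and eq: "\<And>w. w \<in> cball 0 r \<Longrightarrow> \<phi> w = h w * w ^ p \<and> h w \<noteq> 0"
    using zorder_exist_zero[OF hol open_ball connected_ball _ nonzero, of 0] p unfolding h_def
    by (auto simp del: mem_cball)
  have "continuous_on (cball 0 r) (\<lambda>z. norm (h z))"
    using h holomorphic_on_imp_continuous_on continuous_on_norm by blast
  then obtain u where u: "u \<in> cball 0 r" "\<And>z. z \<in> cball 0 r \<Longrightarrow> norm (h u) \<le> norm (h z)"
    using continuous_attains_inf[of "cball 0 r" "\<lambda>z. norm (h z)"] r by auto
  show ?thesis
  proof (rule that[of r "min 1 (norm (h u))"])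
    have "of_real r \<in> cball (0::complex) r" using r by simp
    with r show "r < 1" by fastforce
    show "0 < min 1 (norm (h u))" using eq[OF u(1)] by simp
    show "min 1 (norm (h u)) * norm z ^ p \<le> norm (\<phi> z)" if "norm z \<le> r" for z
    proof -
      have "min 1 (norm (h u)) * norm z ^ p \<le> norm (h z) * norm z ^ p"
        using u(2)[of z] that by (intro mult_right_mono) auto
      then show ?thesis using eq[of z] that by (simp add: norm_mult norm_power)
    qed
  qed (use r in auto)
qed

section \<open>Finite Blaschke products\<close>

lemma finite_blaschke_product_props:
  assumes "finite_blaschke_product \<phi>"
  shows finite_blaschke_product_continuous_on: "continuous_on (cball 0 1) \<phi>"
    and finite_blaschke_product_holomorphic_on: "\<phi> holomorphic_on ball 0 1"
    and finite_blaschke_product_norm_less_1: "\<And>z. norm z < 1 \<Longrightarrow> norm (\<phi> z) < 1"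
    and finite_blaschke_product_nonzero: "\<exists>w\<in>ball 0 1. \<phi> w \<noteq> 0"
proof -
  obtain \<psi> :: real and q :: nat and a where q: "1 \<le> q" and a: "\<And>i. i \<in> {1..q} \<Longrightarrow> norm (a i) < 1"
    and \<phi>: "\<phi> = (\<lambda>z. exp (\<i> * of_real \<psi>) * (\<Prod>i=1..q. (z - a i) / (1 - cnj (a i) * z)))"
    using assms unfolding finite_blaschke_product_def by blast
  have denominator: "cnj (a i) * z \<noteq> 1" if "norm z \<le> 1" "i \<in> {1..q}" for z i
    using szego_denominator_nonzero[OF a[OF that(2)] that(1)] by simp
  show "continuous_on (cball 0 1) \<phi>"
    unfolding \<phi> by (intro continuous_intros) (auto simp: denominator)
  show "\<phi> holomorphic_on ball 0 1"
    unfolding \<phi> by (intro holomorphic_intros) (auto simp: denominator)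
  have factor: "norm ((z - a i) / (1 - cnj (a i) * z)) < 1" if "norm z < 1" "i \<in> {1..q}" for z i
    using Moebius_function_norm_lt_1[OF a[OF that(2)] that(1), of 0]
    by (simp add: Moebius_function_def)
  show "norm (\<phi> z) < 1" if z: "norm z < 1" for z
  proof -
    have "norm (\<phi> z) = (\<Prod>i=1..q. norm ((z - a i) / (1 - cnj (a i) * z)))"
      unfolding \<phi> by (simp add: norm_mult flip: prod_norm)
    also have "\<dots> < (\<Prod>i=1..q. 1)"
      using factor[OF z] q by (intro prod_mono_strict[of 1]) (auto intro: less_imp_le)
    finally show ?thesis by simp
  qed
  \<comment> \<open>The only zeros in the disc are the finitely many \<open>a i\<close>.\<close>
  have "infinite (ball (0::complex) 1 - a ` {1..q})"
    using uncountable_infinite[OF uncountable_ball[of 1 "0::complex"]] by (intro Diff_infinite_finite) auto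
  then obtain w where w: "w \<in> ball 0 1" "w \<notin> a ` {1..q}"
    using infinite_imp_nonempty by blast
  have "\<phi> w \<noteq> 0"
    unfolding \<phi> using w by (auto simp: image_iff denominator)
  with w show "\<exists>w\<in>ball 0 1. \<phi> w \<noteq> 0" by blast
qed

lemma funpow_disc:
  assumes "continuous_on (cball 0 1) \<phi>" and "\<phi> holomorphic_on ball 0 1"
    and "\<And>z::complex. norm z < 1 \<Longrightarrow> norm (\<phi> z) < 1"
  shows funpow_continuous_on_cball: "continuous_on (cball 0 1) (\<phi> ^^ n)"
    and funpow_holomorphic_on_ball: "(\<phi> ^^ n) holomorphic_on ball 0 1"
proof -
  have ball: "\<phi> ` ball 0 1 \<subseteq> ball 0 1"
    using assms(3) by auto
  \<comment> \<open>Invariance of the open disc passes to its closure by continuity.\<close>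
  have "\<phi> ` closure (ball 0 1) \<subseteq> cball 0 1"
    using assms(1) ball by (intro image_closure_subset) (auto intro: less_imp_le)
  then have cball: "\<phi> ` cball 0 1 \<subseteq> cball 0 1"
    by simp
  show "continuous_on (cball 0 1) (\<phi> ^^ n)"
  proof (induction n)
    case (Suc n)
    then show ?case
      unfolding funpow_Suc_right using assms(1) cball
      by (intro continuous_on_compose) (auto intro: continuous_on_subset)
  qed (simp add: id_def)
  show "(\<phi> ^^ n) holomorphic_on ball 0 1"
  proof (induction n)
    case (Suc n)
    then show ?case
      unfolding funpow_Suc_right using assms(2) ball
      by (intro holomorphic_on_compose_gen[of _ _ _ "ball 0 1"]) auto
  qed (simp add: id_def)
qed

section \<open>The lower bound\<close>

lemma correlation_identity_szego:
  assumes \<phi>: "finite_blaschke_product \<phi>" and w: "norm w < 1"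
  shows "correlation \<phi> (\<lambda>z. z) (szego_kernel w) n = norm ((\<phi> ^^ n) w)"
proof -
  note props = finite_blaschke_product_props[OF \<phi>]
  have "circle_integral (\<lambda>z. (\<phi> ^^ n) z * cnj (szego_kernel w z)) = (\<phi> ^^ n) w"
    using props(1-3) w by (intro circle_integral_szego funpow_disc) auto
  moreover have "circle_integral (\<lambda>z. z) = 0"
    by (subst circle_integral_mean_value) auto
  ultimately show ?thesis
    by (simp add: correlation_def)
qed

theorem theorem5p1:
  fixes \<theta> :: real and \<phi> :: "complex \<Rightarrow> complex" and p :: nat and \<gamma> :: real
  assumes "0 < \<theta>" and "\<theta> < 1"
    and "finite_blaschke_product \<phi>"
    and "\<phi> 0 = 0"
    and "zorder \<phi> 0 = int p"
    and "2 \<le> p"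
    and "\<gamma> = ln (real p)"
  shows "\<exists>f\<in>H_theta \<theta>. \<exists>g\<in>H_theta \<theta>. \<exists>C' \<beta>'.
           (\<exists>z\<in>sphere 0 1. f z \<noteq> 0) \<and> (\<exists>z\<in>sphere 0 1. g z \<noteq> 0) \<and> C' > 0 \<and> \<beta>' > 0 \<and>
           infinite {n. correlation \<phi> f g n \<ge>
             C' * exp (- \<beta>' * exp (\<gamma> * real n)) * theta_norm \<theta> f * theta_norm \<theta> g}"
proof -
  note props = finite_blaschke_product_props[OF assms(3)]
  obtain \<delta> c where \<delta>: "0 < \<delta>" "\<delta> < 1" and c: "0 < c" "c \<le> 1"
    and lower: "\<And>z. norm z \<le> \<delta> \<Longrightarrow> c * norm z ^ p \<le> norm (\<phi> z)"
    using zorder_norm_lower_bound[OF props(2) assms(4) props(4) assms(5)] by metis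
  \<comment> \<open>Within \<open>\<delta>\<close> the lower bound for \<open>\<phi>\<close> applies; strictly below \<open>\<theta>\<close> the kernel lies in the space.\<close>
  define r where "r = min \<delta> (\<theta> / 2)"
  define w :: complex where "w = of_real r"
  have r: "0 < r" "r < \<theta>" "r \<le> \<delta>" "r < 1"
    using \<delta> assms(1,2) by (auto simp: r_def)
  have w: "norm w = r" using r by (simp add: w_def)
  have schwarz: "norm (\<phi> z) \<le> norm z" if "norm z < 1" for z
    using Schwarz_Lemma(1)[OF props(2) assms(4) props(3)] that by blast
  have "norm ((\<phi> ^^ n) w) \<le> \<delta>" for n
    using Schwarz_funpow[of \<phi> w n] schwarz w r by simp
  from funpow_norm_lower_bound[OF lower this c assms(6)]
  have growth: "(c * r) ^ (p ^ n) \<le> norm ((\<phi> ^^ n) w)" for n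
    by (simp add: w)
  let ?f = "\<lambda>z::complex. z" and ?g = "szego_kernel w"
  define M where "M = theta_norm \<theta> ?f * theta_norm \<theta> ?g"
  define \<beta> where "\<beta> = - ln (c * r)"
  have M: "0 \<le> M"
    by (auto simp: M_def theta_norm_def theta_term_def intro!: mult_nonneg_nonneg infsum_nonneg
          zero_le_power_int assms less_imp_le[OF assms(1)])
  have cr: "0 < c * r" "c * r < 1"
    using c r mult_le_less_imp_less[of c 1 r 1] by auto
  \<comment> \<open>The constant \<open>1 / (M + 1)\<close> absorbs the product \<open>M\<close> of the two norms without
    their being computed; the \<open>1\<close> avoids a separate proof that \<open>M\<close> is positive.\<close>
  have bound: "correlation \<phi> ?f ?g n \<ge>
      1 / (M + 1) * exp (- \<beta> * exp (\<gamma> * real n)) * theta_norm \<theta> ?f * theta_norm \<theta> ?g" for n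
  proof -
    have "exp (\<gamma> * real n) = real (p ^ n)"
      using assms(6,7) by (simp add: exp_of_nat2_mult)
    then have "exp (- \<beta> * exp (\<gamma> * real n)) = (c * r) ^ (p ^ n)"
      using cr exp_of_nat2_mult[of "ln (c * r)" "p ^ n"] by (simp add: \<beta>_def del: of_nat_power)
    then have "1 / (M + 1) * exp (- \<beta> * exp (\<gamma> * real n)) * theta_norm \<theta> ?f * theta_norm \<theta> ?g =
        M / (M + 1) * (c * r) ^ (p ^ n)"
      by (simp add: M_def)
    also have "\<dots> \<le> 1 * (c * r) ^ (p ^ n)"
      using M cr by (intro mult_right_mono) auto
    also have "\<dots> \<le> norm ((\<phi> ^^ n) w)"
      using growth by simp
    also have "\<dots> = correlation \<phi> ?f ?g n"
      using correlation_identity_szego[OF assms(3)] w r by simp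
    finally show ?thesis .
  qed
  have "laurent_polynomial ?f"
    unfolding laurent_polynomial_def
    by (intro exI[of _ "{1}"] exI[of _ "\<lambda>_. 1"]) auto
  then have f: "?f \<in> H_theta \<theta>"
    by (intro laurent_polynomial_in_H_theta) auto
  have g: "?g \<in> H_theta \<theta>"
    using szego_kernel_in_H_theta[OF assms(1,2)] w r by simp
  have "?g 1 \<noteq> 0"
    using szego_denominator_nonzero[of w 1] w r by (simp add: szego_kernel_def)
  then have "\<exists>z\<in>sphere 0 1. ?g z \<noteq> 0"
    by (intro bexI[of _ 1]) auto
  moreover have "\<exists>z\<in>sphere 0 1. ?f z \<noteq> 0"
    by (intro bexI[of _ 1]) auto
  moreover have "0 < 1 / (M + 1)" "0 < \<beta>"
    using M cr by (auto simp: \<beta>_def)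
  moreover have "infinite {n. correlation \<phi> ?f ?g n \<ge>
      1 / (M + 1) * exp (- \<beta> * exp (\<gamma> * real n)) * theta_norm \<theta> ?f * theta_norm \<theta> ?g}"
    using bound by simp
  ultimately show ?thesis
    by (intro bexI[OF _ f] bexI[OF _ g] exI[of _ "1 / (M + 1)"] exI[of _ \<beta>] conjI)
qed

end
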